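(* Let $m,n\ge1$, let $\omega\in(0,1]$, and let $A\in\mathbb{R}^{m\times n}$ be a column distinct matrix. Then the following hold for the solution set $\mathcal{S}(A,\omega)$ of the normalized equation $A\otimes_\omega x=\mathbf{0}$: (i) if $m>n$, then $|\mathcal{S}(A,\omega)|=0$; (ii) if $m=n$, then $0\le|\mathcal{S}(A,\omega)|<+\infty$; (iii) if $m<n$, then $|\mathcal{S}(A,\omega)|\in\{0,+\infty\}$.
   Context: Let $N=\{1,\ldots,n\}$. For $\omega\in(0,1]$, $A\in\mathbb{R}^{m\times n}$ and $x\in\mathbb{R}^n$, $A\otimes_\omega x\in\mathbb{R}^m$ is the vector whose $i$-th entry is the $\lceil\omega n\rceil$-th smallest element (counted with multiplicity) of the multiset $\{A(i,j)+x_j : j\in N\}$. $\mathcal{S}(A,\omega)=\{x\in\mathbb{R}^n : A\otimes_\omega x=\mathbf{0}\}$. $A$ is column distinct if, in each column of $A$, the entries are pairwise distinct. $|\cdot|$ denotes the number of elements, with $+\infty$ meaning that the set is infinite. *)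

theory Defs
  imports "HOL-Analysis.Analysis" "HOL-Library.Multiset" "HOL-Library.Extended_Nat"
begin

(* 1-based order statistic, counted with multiplicity; meaningful for 1 \<le> k \<le> size M. *)
definition kth_smallest :: "nat \<Rightarrow> 'a::linorder multiset \<Rightarrow> 'a" where
  "kth_smallest k M = sorted_list_of_multiset M ! (k - 1)"

(* For 0 < \<omega> \<le> 1 the rank is between 1 and n = CARD('n), so kth_smallest is
   only used within its meaningful range. *)
definition omega_mult :: "real \<Rightarrow> real^'n^'m \<Rightarrow> real^'n \<Rightarrow> real^'m" where
  "omega_mult \<omega> A x =
     (\<chi> i. kth_smallest (nat \<lceil>\<omega> * real CARD('n)\<rceil>)
             (image_mset (\<lambda>j. A $ i $ j + x $ j) (mset_set UNIV)))"

definition solution_set :: "real^'n^'m \<Rightarrow> real \<Rightarrow> (real^'n) set" where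
  "solution_set A \<omega> = {x. omega_mult \<omega> A x = 0}"

definition column_distinct :: "real^'n^'m \<Rightarrow> bool" where
  "column_distinct A \<longleftrightarrow> (\<forall>j. inj (\<lambda>i. A $ i $ j))"

(* The library's card maps infinite sets to 0. *)
definition ecard :: "'a set \<Rightarrow> enat" where
  "ecard S = (if finite S then enat (card S) else \<infinity>)"

end

theory Submission
  imports Defs
begin

text \<open>
  An order statistic of a row vanishes iff fewer than \<open>k\<close> entries of the row are negative and at
  least \<open>k\<close> are nonpositive, where \<open>k\<close> is the rank (\<open>solution_iff_counts\<close>). Hence whether \<open>x\<close> is a
  solution depends only on the signs of the numbers \<open>A i j + x j\<close>, and every row of a solution
  contains a zero. Column distinctness allows at most one zero per column, so picking a zero in
  each row gives an injection \<open>\<sigma>\<close> from rows to columns (\<open>solution_zero_selector\<close>).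

  This rules out solutions when there are more rows than columns. With equally many, \<open>\<sigma>\<close> is
  onto, so each \<open>x j\<close> is one of the finitely many numbers \<open>- A i j\<close>. With fewer rows than columns,
  some column \<open>j0\<close> is missed by \<open>\<sigma>\<close>, and the entry \<open>x j0\<close> can be moved. A small move keeps every
  sign except at the possible zero of column \<open>j0\<close>. The row of that zero has another zero, chosen
  by \<open>\<sigma>\<close>, hence at least two: its counts of negative and nonpositive entries differ by at least two,
  so there is room either to remove one nonpositive entry (move up) or to add one negative entry
  (move down). One solution thus yields an interval of solutions.
\<close>

section \<open>Order statistics through counting\<close>

text \<open>In a sorted list the elements with a downward closed property form an initial segment.\<close>

lemma sorted_nth_iff_less_length_filter:
  assumes "sorted xs" and "i < length xs" and down: "\<And>u v. u \<le> v \<Longrightarrow> P v \<Longrightarrow> P u"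
  shows "P (xs ! i) \<longleftrightarrow> i < length (filter P xs)"
  using assms(1,2)
proof (induction xs arbitrary: i)
  case Nil
  then show ?case by simp
next
  case (Cons a xs)
  show ?case
  proof (cases "P a")
    case True
    then show ?thesis using Cons by (cases i) auto
  next
    case False
    then have none: "\<not> P y" if "y \<in> set (a # xs)" for y
      using that Cons.prems(1) down by auto
    then have "filter P (a # xs) = []"
      by (simp add: filter_empty_conv)
    moreover have "\<not> P ((a # xs) ! i)"
      using none nth_mem Cons.prems(2) by blast
    ultimately show ?thesis by simp
  qed
qed

lemma kth_smallest_iff_le_size_filter:
  assumes "1 \<le> k" and "k \<le> size M" and down: "\<And>u v. u \<le> v \<Longrightarrow> P v \<Longrightarrow> P u"
  shows "P (kth_smallest k M) \<longleftrightarrow> k \<le> size (filter_mset P M)"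
proof -
  let ?xs = "sorted_list_of_multiset M"
  have M: "mset ?xs = M" by simp
  then have len: "length ?xs = size M" by (metis size_mset)
  have "length (filter P ?xs) = size (filter_mset P M)"
    by (metis M mset_filter size_mset)
  with sorted_nth_iff_less_length_filter[of ?xs "k - 1" P] assms len show ?thesis
    by (auto simp: kth_smallest_def)
qed

lemma kth_smallest_eq_iff:
  assumes "1 \<le> k" and "k \<le> size M"
  shows "kth_smallest k M = c \<longleftrightarrow>
    size (filter_mset (\<lambda>v. v < c) M) < k \<and> k \<le> size (filter_mset (\<lambda>v. v \<le> c) M)"
proof -
  have "kth_smallest k M < c \<longleftrightarrow> k \<le> size (filter_mset (\<lambda>v. v < c) M)"
    using assms by (rule kth_smallest_iff_le_size_filter) auto
  moreover have "kth_smallest k M \<le> c \<longleftrightarrow> k \<le> size (filter_mset (\<lambda>v. v \<le> c) M)"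
    using assms by (rule kth_smallest_iff_le_size_filter) auto
  ultimately show ?thesis by auto
qed

lemma size_filter_image_mset_set:
  assumes "finite S"
  shows "size (filter_mset P (image_mset f (mset_set S))) = card {j \<in> S. P (f j)}"
  using assms by (simp add: filter_mset_image_mset)

section \<open>Solutions as sign patterns\<close>

definition order_rank :: "real \<Rightarrow> 'n itself \<Rightarrow> nat" where
  "order_rank \<omega> _ = nat \<lceil>\<omega> * real CARD('n)\<rceil>"

definition neg_cols :: "real^'n^'m \<Rightarrow> real^'n \<Rightarrow> 'm \<Rightarrow> 'n set" where
  "neg_cols A x i = {j. A $ i $ j + x $ j < 0}"

definition nonpos_cols :: "real^'n^'m \<Rightarrow> real^'n \<Rightarrow> 'm \<Rightarrow> 'n set" where
  "nonpos_cols A x i = {j. A $ i $ j + x $ j \<le> 0}"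

lemma order_rank_bounds:
  assumes "0 < \<omega>" and "\<omega> \<le> 1"
  shows "1 \<le> order_rank \<omega> TYPE('n::finite)" and "order_rank \<omega> TYPE('n) \<le> CARD('n)"
proof -
  have "0 < \<omega> * real CARD('n)" using assms by simp
  then show "1 \<le> order_rank \<omega> TYPE('n)"
    unfolding order_rank_def by linarith
  have "\<omega> * real CARD('n) \<le> real CARD('n)"
    using assms by (simp add: mult_left_le_one_le)
  then show "order_rank \<omega> TYPE('n) \<le> CARD('n)"
    unfolding order_rank_def by linarith
qed

lemma solution_iff_counts:
  fixes A :: "real^'n^'m"
  assumes "0 < \<omega>" and "\<omega> \<le> 1"
  shows "x \<in> solution_set A \<omega> \<longleftrightarrow>
    (\<forall>i. card (neg_cols A x i) < order_rank \<omega> TYPE('n) \<and> order_rank \<omega> TYPE('n) \<le> card (nonpos_cols A x i))"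
proof -
  have "kth_smallest (order_rank \<omega> TYPE('n)) (image_mset (\<lambda>j. A $ i $ j + x $ j) (mset_set UNIV)) = 0
    \<longleftrightarrow> card (neg_cols A x i) < order_rank \<omega> TYPE('n) \<and> order_rank \<omega> TYPE('n) \<le> card (nonpos_cols A x i)" for i
    using order_rank_bounds[OF assms, where 'n = 'n]
    by (subst kth_smallest_eq_iff)
      (simp_all add: size_filter_image_mset_set neg_cols_def nonpos_cols_def)
  then show ?thesis
    by (simp add: solution_set_def omega_mult_def vec_eq_iff order_rank_def)
qed

text \<open>Two zeros in the same column would make two entries of that column equal; hence the
  injectivity.\<close>

lemma solution_zero_selector:
  fixes A :: "real^'n^'m"
  assumes "0 < \<omega>" and "\<omega> \<le> 1" and "column_distinct A" and "x \<in> solution_set A \<omega>"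
  obtains \<sigma> :: "'m \<Rightarrow> 'n" where "inj \<sigma>" and "\<And>i. A $ i $ \<sigma> i + x $ \<sigma> i = 0"
proof -
  have "\<exists>j. A $ i $ j + x $ j = 0" for i
  proof (rule ccontr)
    assume "\<nexists>j. A $ i $ j + x $ j = 0"
    then have "nonpos_cols A x i = neg_cols A x i"
      by (auto simp: nonpos_cols_def neg_cols_def order_le_less)
    with assms show False
      by (metis solution_iff_counts not_le)
  qed
  then obtain \<sigma> where \<sigma>: "\<And>i. A $ i $ \<sigma> i + x $ \<sigma> i = 0" by metis
  have "inj \<sigma>"
  proof (rule injI)
    fix i i' assume "\<sigma> i = \<sigma> i'"
    then have "A $ i $ \<sigma> i = A $ i' $ \<sigma> i" using \<sigma>[of i] \<sigma>[of i'] by simp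
    with assms(3) show "i = i'" by (auto simp: column_distinct_def dest: injD)
  qed
  then show thesis using \<sigma> that by blast
qed

section \<open>Counting solutions\<close>

lemma solution_set_empty_if_more_rows:
  fixes A :: "real^'n^'m"
  assumes "0 < \<omega>" and "\<omega> \<le> 1" and "column_distinct A" and "CARD('n) < CARD('m)"
  shows "solution_set A \<omega> = {}"
proof (rule ccontr)
  assume "solution_set A \<omega> \<noteq> {}"
  then obtain x where "x \<in> solution_set A \<omega>" by blast
  then obtain \<sigma> :: "'m \<Rightarrow> 'n" where "inj \<sigma>"
    using solution_zero_selector assms by metis
  then have "CARD('m) \<le> CARD('n)"
    by (metis card_inj_on_le finite_class.finite_UNIV top_greatest)
  with assms(4) show False by simp
qed

lemma finite_solution_set_if_square:
  fixes A :: "real^'n^'m"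
  assumes "0 < \<omega>" and "\<omega> \<le> 1" and "column_distinct A" and "CARD('m) = CARD('n)"
  shows "finite (solution_set A \<omega>)"
proof -
  have "solution_set A \<omega> \<subseteq> (\<lambda>\<tau> :: 'n \<Rightarrow> 'm. \<chi> j. - (A $ \<tau> j $ j)) ` UNIV"
  proof
    fix x assume "x \<in> solution_set A \<omega>"
    then obtain \<sigma> :: "'m \<Rightarrow> 'n" where "inj \<sigma>" and \<sigma>: "\<And>i. A $ i $ \<sigma> i + x $ \<sigma> i = 0"
      using solution_zero_selector assms by metis
    then have "range \<sigma> = UNIV"
      using assms(4) by (simp add: card_eq_UNIV_imp_eq_UNIV card_image)
    then have "\<sigma> (inv \<sigma> j) = j" for j
      by (rule surj_f_inv_f)
    then have "x $ j = - (A $ inv \<sigma> j $ j)" for j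
      using \<sigma>[of "inv \<sigma> j"] by simp
    then have "x = (\<chi> j. - (A $ inv \<sigma> j $ j))"
      by (simp add: vec_eq_iff)
    then show "x \<in> (\<lambda>\<tau> :: 'n \<Rightarrow> 'm. \<chi> j. - (A $ \<tau> j $ j)) ` UNIV" by blast
  qed
  then show ?thesis by (rule finite_subset) simp
qed

definition replace_entry :: "real^'n \<Rightarrow> 'n \<Rightarrow> real \<Rightarrow> real^'n" where
  "replace_entry x j0 t = (\<chi> j. if j = j0 then t else x $ j)"

lemma infinite_if_interval_of_replacements:
  assumes "a < b" and "\<And>t. a < t \<Longrightarrow> t < b \<Longrightarrow> replace_entry x j0 t \<in> S"
  shows "infinite S"
proof
  assume "finite S"
  moreover have "replace_entry x j0 ` {a<..<b} \<subseteq> S" using assms(2) by auto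
  moreover have "inj_on (replace_entry x j0) {a<..<b}"
    by (auto simp: inj_on_def replace_entry_def vec_eq_iff)
  ultimately have "finite {a<..<b}"
    by (meson finite_imageD finite_subset)
  with assms(1) infinite_Ioo show False by blast
qed

text \<open>Raising \<open>x j0\<close> makes a zero in column \<open>j0\<close> positive, which costs its row one nonpositive
  entry; the strict inequality in the slack assumption pays for it. All other signs survive a
  small enough increase.\<close>

lemma infinite_solution_set_if_upward_slack:
  fixes A :: "real^'n^'m"
  assumes \<omega>: "0 < \<omega>" "\<omega> \<le> 1" and x: "x \<in> solution_set A \<omega>"
    and slack: "\<And>i. A $ i $ j0 + x $ j0 = 0 \<Longrightarrow> order_rank \<omega> TYPE('n) < card (nonpos_cols A x i)"
  shows "infinite (solution_set A \<omega>)"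
proof -
  let ?c = "x $ j0"
  have "\<forall>\<^sub>F t in at_right ?c. A $ i $ j0 + ?c < 0 \<longrightarrow> A $ i $ j0 + t < 0" for i
  proof (cases "A $ i $ j0 + ?c < 0")
    case True
    then show ?thesis
      unfolding eventually_at_right_field by (intro exI[of _ "- A $ i $ j0"]) auto
  qed simp
  then have "\<forall>\<^sub>F t in at_right ?c. \<forall>i. A $ i $ j0 + ?c < 0 \<longrightarrow> A $ i $ j0 + t < 0"
    by (simp add: eventually_all_finite)
  then obtain b where "?c < b"
    and b: "\<And>t i. ?c < t \<Longrightarrow> t < b \<Longrightarrow> A $ i $ j0 + ?c < 0 \<Longrightarrow> A $ i $ j0 + t < 0"
    unfolding eventually_at_right_field by metis
  have "replace_entry x j0 t \<in> solution_set A \<omega>" if t: "?c < t" "t < b" for t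
    unfolding solution_iff_counts[OF \<omega>]
  proof
    fix i
    let ?y = "replace_entry x j0 t"
    have old: "card (neg_cols A x i) < order_rank \<omega> TYPE('n)"
        "order_rank \<omega> TYPE('n) \<le> card (nonpos_cols A x i)"
      using x solution_iff_counts[OF \<omega>] by auto
    have neg: "neg_cols A ?y i = neg_cols A x i"
      using t b[OF t, of i] by (auto simp: neg_cols_def replace_entry_def split: if_splits)
    show "card (neg_cols A ?y i) < order_rank \<omega> TYPE('n) \<and> order_rank \<omega> TYPE('n) \<le> card (nonpos_cols A ?y i)"
    proof (cases "A $ i $ j0 + ?c = 0")
      case True
      then have "nonpos_cols A ?y i = nonpos_cols A x i - {j0}" and "j0 \<in> nonpos_cols A x i"
        using t by (auto simp: nonpos_cols_def replace_entry_def split: if_splits)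
      then show ?thesis using neg old slack[OF True] by simp
    next
      case False
      then have "nonpos_cols A ?y i = nonpos_cols A x i"
        using t b[OF t, of i]
        by (auto simp: nonpos_cols_def replace_entry_def split: if_splits)
      then show ?thesis using neg old by simp
    qed
  qed
  with \<open>?c < b\<close> show ?thesis by (rule infinite_if_interval_of_replacements)
qed

text \<open>Lowering \<open>x j0\<close> keeps a zero in column \<open>j0\<close> nonpositive but makes it negative, so here the
  slack is needed in the count of negative entries.\<close>

lemma infinite_solution_set_if_downward_slack:
  fixes A :: "real^'n^'m"
  assumes \<omega>: "0 < \<omega>" "\<omega> \<le> 1" and x: "x \<in> solution_set A \<omega>"
    and slack: "\<And>i. A $ i $ j0 + x $ j0 = 0 \<Longrightarrow> card (neg_cols A x i) + 1 < order_rank \<omega> TYPE('n)"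
  shows "infinite (solution_set A \<omega>)"
proof -
  let ?c = "x $ j0"
  have "\<forall>\<^sub>F t in at_left ?c. A $ i $ j0 + ?c > 0 \<longrightarrow> A $ i $ j0 + t > 0" for i
  proof (cases "A $ i $ j0 + ?c > 0")
    case True
    then show ?thesis
      unfolding eventually_at_left_field by (intro exI[of _ "- A $ i $ j0"]) auto
  qed simp
  then have "\<forall>\<^sub>F t in at_left ?c. \<forall>i. A $ i $ j0 + ?c > 0 \<longrightarrow> A $ i $ j0 + t > 0"
    by (simp add: eventually_all_finite)
  then obtain b where "b < ?c"
    and b: "\<And>t i. b < t \<Longrightarrow> t < ?c \<Longrightarrow> A $ i $ j0 + ?c > 0 \<Longrightarrow> A $ i $ j0 + t > 0"
    unfolding eventually_at_left_field by metis
  have "replace_entry x j0 t \<in> solution_set A \<omega>" if t: "b < t" "t < ?c" for t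
    unfolding solution_iff_counts[OF \<omega>]
  proof
    fix i
    let ?y = "replace_entry x j0 t"
    have old: "card (neg_cols A x i) < order_rank \<omega> TYPE('n)"
        "order_rank \<omega> TYPE('n) \<le> card (nonpos_cols A x i)"
      using x solution_iff_counts[OF \<omega>] by auto
    have nonpos: "nonpos_cols A ?y i = nonpos_cols A x i"
      using t b[OF t, of i]
      by (force simp: nonpos_cols_def replace_entry_def split: if_splits)
    show "card (neg_cols A ?y i) < order_rank \<omega> TYPE('n) \<and> order_rank \<omega> TYPE('n) \<le> card (nonpos_cols A ?y i)"
    proof (cases "A $ i $ j0 + ?c = 0")
      case True
      then have "neg_cols A ?y i = insert j0 (neg_cols A x i)" and "j0 \<notin> neg_cols A x i"
        using t by (auto simp: neg_cols_def replace_entry_def split: if_splits)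
      then show ?thesis using nonpos old slack[OF True] by simp
    next
      case False
      then have "neg_cols A ?y i = neg_cols A x i"
        using t b[OF t, of i]
        by (force simp: neg_cols_def replace_entry_def split: if_splits)
      then show ?thesis using nonpos old by simp
    qed
  qed
  with \<open>b < ?c\<close> show ?thesis by (rule infinite_if_interval_of_replacements)
qed

lemma infinite_solution_set_if_fewer_rows:
  fixes A :: "real^'n^'m"
  assumes \<omega>: "0 < \<omega>" "\<omega> \<le> 1" and A: "column_distinct A" and "CARD('m) < CARD('n)"
    and x: "x \<in> solution_set A \<omega>"
  shows "infinite (solution_set A \<omega>)"
proof -
  obtain \<sigma> :: "'m \<Rightarrow> 'n" where \<sigma>: "\<And>i. A $ i $ \<sigma> i + x $ \<sigma> i = 0"
    using solution_zero_selector[OF \<omega> A x] by metis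
  have "range \<sigma> \<noteq> UNIV"
    using assms(4) card_image_le[of UNIV \<sigma>] by auto
  then obtain j0 where j0: "j0 \<notin> range \<sigma>" by blast
  show ?thesis
  proof (cases "\<forall>i. A $ i $ j0 + x $ j0 = 0 \<longrightarrow> order_rank \<omega> TYPE('n) < card (nonpos_cols A x i)")
    case True
    then show ?thesis using infinite_solution_set_if_upward_slack[OF \<omega> x] by blast
  next
    case False
    then obtain i0 where i0: "A $ i0 $ j0 + x $ j0 = 0"
      "card (nonpos_cols A x i0) \<le> order_rank \<omega> TYPE('n)" by (auto simp: not_less)
    have ne: "\<sigma> i0 \<noteq> j0" using j0 by auto
    \<comment> \<open>The row \<open>i0\<close> has zeros in the two columns \<open>j0\<close> and \<open>\<sigma> i0\<close>.\<close>
    have "insert j0 (insert (\<sigma> i0) (neg_cols A x i0)) \<subseteq> nonpos_cols A x i0"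
      using i0(1) \<sigma>[of i0] by (auto simp: neg_cols_def nonpos_cols_def)
    then have "card (insert j0 (insert (\<sigma> i0) (neg_cols A x i0))) \<le> card (nonpos_cols A x i0)"
      by (intro card_mono) auto
    moreover have "j0 \<notin> neg_cols A x i0" "\<sigma> i0 \<notin> neg_cols A x i0"
      using i0(1) \<sigma>[of i0] by (auto simp: neg_cols_def)
    ultimately have slack: "card (neg_cols A x i0) + 1 < order_rank \<omega> TYPE('n)"
      using ne i0(2) by auto
    have "i = i0" if "A $ i $ j0 + x $ j0 = 0" for i
    proof -
      have "A $ i $ j0 = A $ i0 $ j0" using that i0(1) by simp
      with A show ?thesis by (auto simp: column_distinct_def dest: injD)
    qed
    then show ?thesis using infinite_solution_set_if_downward_slack[OF \<omega> x] slack by blast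
  qed
qed

theorem corollary5p10:
  fixes A :: "real^'n^'m" and \<omega> :: real
  assumes "0 < \<omega>" and "\<omega> \<le> 1"
    and "column_distinct A"
  shows "(CARD('m) > CARD('n) \<longrightarrow> ecard (solution_set A \<omega>) = 0) \<and>
         (CARD('m) = CARD('n) \<longrightarrow>
            0 \<le> ecard (solution_set A \<omega>) \<and> ecard (solution_set A \<omega>) < \<infinity>) \<and>
         (CARD('m) < CARD('n) \<longrightarrow> ecard (solution_set A \<omega>) \<in> {0, \<infinity>})"
proof (intro conjI impI)
  assume "CARD('m) > CARD('n)"
  then show "ecard (solution_set A \<omega>) = 0"
    using solution_set_empty_if_more_rows[OF assms] by (simp add: ecard_def zero_enat_def)
next
  show "0 \<le> ecard (solution_set A \<omega>)" by simp
next
  assume "CARD('m) = CARD('n)"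
  then show "ecard (solution_set A \<omega>) < \<infinity>"
    using finite_solution_set_if_square[OF assms] by (simp add: ecard_def)
next
  assume "CARD('m) < CARD('n)"
  then show "ecard (solution_set A \<omega>) \<in> {0, \<infinity>}"
    using infinite_solution_set_if_fewer_rows[OF assms]
    by (cases "solution_set A \<omega> = {}") (auto simp: ecard_def zero_enat_def)
qed

end
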